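(* Symmetric enhanced Leibniz algebras $(t\colon\mathbb{W}\to\mathbb{V},[\cdot,\cdot],\circ)$ with injective map $t$ are in one-to-one correspondence (identifying $\mathbb{W}$ with its image under $t$) with Leibniz couples $\mathbb{V}\supset\mathfrak{i}$, where the ideal $\mathfrak{i}$ corresponds to the image of $t$: $\mathfrak{i}=t(\mathbb{W})\cong\mathbb{W}$. For general, not necessarily symmetric ELAs with injective $t$, the one-to-one correspondence is with pairs consisting of a Leibniz couple $\mathbb{V}\supset\mathfrak{i}$ and an element $\beta\in\Lambda^2\mathbb{V}^*\otimes\mathbb{W}$, where $\mathbb{W}\cong\mathfrak{i}$.
   Context: All vector spaces are over a field $\mathbb{K}$ of characteristic different from $2$. A (left) Leibniz algebra $(\mathbb{V},[\cdot,\cdot])$ is a vector space with a bilinear bracket satisfying $[v_1,[v_2,v_3]]=[[v_1,v_2],v_3]+[v_2,[v_1,v_3]]$. An enhanced Leibniz algebra (ELA) $(t\colon\mathbb{W}\to\mathbb{V},[\cdot,\cdot],\circ)$ consists of a left Leibniz algebra $(\mathbb{V},[\cdot,\cdot])$, a vector space $\mathbb{W}$, a linear map $t\colon\mathbb{W}\to\mathbb{V}$, and a bilinear product $\circ\colon\mathbb{V}\times\mathbb{V}\to\mathbb{W}$ such that for all $u,v\in\mathbb{V}$, $w\in\mathbb{W}$: (a) $[t(w),v]=0$; (b) $t(w)\circ t(w)=0$; (c) $u\stackrel{s}{\circ}[v,v]=v\stackrel{s}{\circ}[u,v]$; (d) $[v,v]=t(v\circ v)$; here $u\stackrel{s}{\circ}v:=\tfrac12(u\circ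 v+v\circ u)$. It is symmetric (an sELA) if $\circ$ is symmetric. $\Lambda^2\mathbb{V}^*\otimes\mathbb{W}$ denotes alternating bilinear maps $\mathbb{V}\times\mathbb{V}\to\mathbb{W}$. For a Leibniz algebra $\mathbb{V}$, $\mathrm{Sq}(\mathbb{V})$ is the linear span of all $[x,x]$, $x\in\mathbb{V}$, and $Z_L(\mathbb{V})=\{x\in\mathbb{V}\mid[x,y]=0\ \forall y\in\mathbb{V}\}$. A Leibniz couple $\mathbb{V}\supset\mathfrak{i}$ is a Leibniz algebra $\mathbb{V}$ with a left ideal $\mathfrak{i}$ (i.e. $[\mathbb{V},\mathfrak{i}]\subset\mathfrak{i}$) such that $\mathrm{Sq}(\mathbb{V})\subset\mathfrak{i}\subset Z_L(\mathbb{V})$. Explicitly, the one-to-one correspondence means: for an sELA with $t$ injective, $\mathbb{V}\supset\operatorname{im}(t)$ is a Leibniz couple, and for every Leibniz algebra $\mathbb{V}$ and injective linear map $t\colon\mathbb{W}\to\mathbb{V}$ such that $\mathbb{V}\supset\operatorname{im}(t)$ is a Leibniz couple there is exactly one symmetric product $\circ$ making $(t,[\cdot,\cdot],\circ)$ an sELA; in the non-symmetric case, the products $\circ$ making $(t,[\cdot,\cdot],\circ)$ an ELA are exactly those obtained by adding an arbitrary $\beta$ to this symmetric one. *)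

theory Defs
  imports "HOL-Computational_Algebra.Computational_Algebra"
begin

text \<open>
  A vector space is a locale instance \<open>vector_space scale\<close> carried by a whole type, except for
  the space \<open>W\<close> of an enhanced Leibniz algebra, which is a linear subspace of a vector space
  (possibly all of it). Thus the ideal of a Leibniz couple is itself an admissible \<open>W\<close>.
\<close>

definition linear_on ::
    "('k \<Rightarrow> 'w::ab_group_add \<Rightarrow> 'w) \<Rightarrow> ('k \<Rightarrow> 'v::ab_group_add \<Rightarrow> 'v) \<Rightarrow> 'w set \<Rightarrow> ('w \<Rightarrow> 'v) \<Rightarrow> bool"
  where "linear_on sW sV W t \<longleftrightarrow>
    (\<forall>x\<in>W. \<forall>y\<in>W. t (x + y) = t x + t y) \<and> (\<forall>c. \<forall>x\<in>W. t (sW c x) = sV c (t x))"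

definition bilinear_into ::
    "('k::field \<Rightarrow> 'v::ab_group_add \<Rightarrow> 'v) \<Rightarrow> ('k \<Rightarrow> 'w::ab_group_add \<Rightarrow> 'w) \<Rightarrow> 'w set
      \<Rightarrow> ('v \<Rightarrow> 'v \<Rightarrow> 'w) \<Rightarrow> bool"
  where "bilinear_into sV sW W f \<longleftrightarrow>
    (\<forall>u. Vector_Spaces.linear sV sW (f u)) \<and> (\<forall>v. Vector_Spaces.linear sV sW (\<lambda>u. f u v)) \<and>
    (\<forall>u v. f u v \<in> W)"

definition alternating_into ::
    "('k::field \<Rightarrow> 'v::ab_group_add \<Rightarrow> 'v) \<Rightarrow> ('k \<Rightarrow> 'w::ab_group_add \<Rightarrow> 'w) \<Rightarrow> 'w set
      \<Rightarrow> ('v \<Rightarrow> 'v \<Rightarrow> 'w) \<Rightarrow> bool"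
  where "alternating_into sV sW W \<beta> \<longleftrightarrow> bilinear_into sV sW W \<beta> \<and> (\<forall>v. \<beta> v v = 0)"

definition sym_part :: "('k::field \<Rightarrow> 'w::ab_group_add \<Rightarrow> 'w) \<Rightarrow> ('v \<Rightarrow> 'v \<Rightarrow> 'w) \<Rightarrow> 'v \<Rightarrow> 'v \<Rightarrow> 'w"
  where "sym_part sW m u v = sW (1 / 2) (m u v + m v u)"

definition alt_part :: "('k::field \<Rightarrow> 'w::ab_group_add \<Rightarrow> 'w) \<Rightarrow> ('v \<Rightarrow> 'v \<Rightarrow> 'w) \<Rightarrow> 'v \<Rightarrow> 'v \<Rightarrow> 'w"
  where "alt_part sW m u v = sW (1 / 2) (m u v - m v u)"

locale leibniz_algebra = vector_space scale
  for scale :: "'k::field \<Rightarrow> 'v::ab_group_add \<Rightarrow> 'v" +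
  fixes br :: "'v \<Rightarrow> 'v \<Rightarrow> 'v"
  assumes bilinear_br: "bilinear_into scale scale UNIV br"
    and left_leibniz: "br x (br y z) = br (br x y) z + br y (br x z)"
begin

definition Sq :: "'v set"
  where "Sq = span {br x x | x. True}"

definition left_center :: "'v set"
  where "left_center = {x. \<forall>y. br x y = 0}"

definition left_ideal :: "'v set \<Rightarrow> bool"
  where "left_ideal I \<longleftrightarrow> subspace I \<and> (\<forall>v. \<forall>x\<in>I. br v x \<in> I)"

end

locale leibniz_couple = leibniz_algebra scale br
  for scale :: "'k::field \<Rightarrow> 'v::ab_group_add \<Rightarrow> 'v" and br +
  fixes I :: "'v set"
  assumes left_ideal_I: "left_ideal I"
    and Sq_subset: "Sq \<subseteq> I"
    and subset_left_center: "I \<subseteq> left_center"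

locale enhanced_leibniz_algebra =
  V: leibniz_algebra sV br + W: vector_space sW
  for sV :: "'k::field \<Rightarrow> 'v::ab_group_add \<Rightarrow> 'v" and br
    and sW :: "'k \<Rightarrow> 'w::ab_group_add \<Rightarrow> 'w" +
  fixes W :: "'w set" and t :: "'w \<Rightarrow> 'v" and m :: "'v \<Rightarrow> 'v \<Rightarrow> 'w"
  assumes subspace_W: "W.subspace W"
    and linear_t: "linear_on sW sV W t"
    and bilinear_m: "bilinear_into sV sW W m"
    and br_t: "w \<in> W \<Longrightarrow> br (t w) v = 0"
    and m_t_t: "w \<in> W \<Longrightarrow> m (t w) (t w) = 0"
    and sym_part_br: "sym_part sW m u (br v v) = sym_part sW m v (br u v)"
    and br_self: "br v v = t (m v v)"

locale symmetric_enhanced_leibniz_algebra = enhanced_leibniz_algebra +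
  assumes symmetric_m: "m u v = m v u"

end

theory Submission
  imports Defs
begin

text \<open>
  Polarising \<open>[v, v] = t (v \<circ> v)\<close> shows that \<open>t\<close> maps the symmetric part of \<open>\<circ>\<close> to
  \<open>([u, v] + [v, u]) / 2\<close>. If \<open>t\<close> is injective, this determines the symmetric part, while the
  alternating part is unconstrained: the remaining two axioms on \<open>\<circ>\<close> become, after applying \<open>t\<close>,
  the Leibniz identity and the vanishing of \<open>[t w, t w]\<close>.
\<close>

section \<open>Bilinear and alternating maps over a field where 2 is invertible\<close>

lemma two_neq_zero_if_CHAR_neq_2:
  assumes "CHAR('k::field) \<noteq> 2"
  shows "(2::'k) \<noteq> 0"
proof
  assume "(2::'k) = 0"
  then have "of_nat 2 = (0::'k)" by simp
  then have "CHAR('k) dvd 2" by (simp only: of_nat_eq_0_iff_char_dvd)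
  then have "CHAR('k) = 1 \<or> CHAR('k) = 2" using two_is_prime_nat prime_nat_iff by blast
  then show False using assms CHAR_not_1'[where ?'a = 'k] by simp
qed

text \<open>Turns the locale predicate into plain equations; the two assumptions supply the
  \<open>vector_space\<close> conjuncts contained in \<open>Vector_Spaces.linear\<close>.\<close>

lemma bilinear_into_iff:
  assumes "vector_space sV" and "vector_space sW"
  shows "bilinear_into sV sW W f \<longleftrightarrow>
    (\<forall>u v v'. f u (v + v') = f u v + f u v') \<and> (\<forall>u u' v. f (u + u') v = f u v + f u' v) \<and>
    (\<forall>c u v. f u (sV c v) = sW c (f u v)) \<and> (\<forall>c u v. f (sV c u) v = sW c (f u v)) \<and>
    (\<forall>u v. f u v \<in> W)"
  using assms unfolding bilinear_into_def Vector_Spaces.linear_iff by blast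

lemma bilinear_into_add:
  assumes "vector_space sV" and "vector_space sW" and "module.subspace sW W"
    and "bilinear_into sV sW W f" and "bilinear_into sV sW W g"
  shows "bilinear_into sV sW W (\<lambda>u v. f u v + g u v)"
proof -
  interpret W: vector_space sW by fact
  show ?thesis
    using assms(4,5) W.subspace_add[OF assms(3)]
    by (auto simp: bilinear_into_iff[OF assms(1,2)] algebra_simps)
qed

lemma bilinear_into_diff:
  assumes "vector_space sV" and "vector_space sW" and "module.subspace sW W"
    and "bilinear_into sV sW W f" and "bilinear_into sV sW W g"
  shows "bilinear_into sV sW W (\<lambda>u v. f u v - g u v)"
proof -
  interpret W: vector_space sW by fact
  show ?thesis
    using assms(4,5) W.subspace_diff[OF assms(3)]
    by (auto simp: bilinear_into_iff[OF assms(1,2)] algebra_simps)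
qed

lemma bilinear_into_scale:
  assumes "vector_space sV" and "vector_space sW" and "module.subspace sW W"
    and "bilinear_into sV sW W f"
  shows "bilinear_into sV sW W (\<lambda>u v. sW c (f u v))"
proof -
  interpret W: vector_space sW by fact
  show ?thesis
    using assms(4) W.subspace_scale[OF assms(3)]
    by (auto simp: bilinear_into_iff[OF assms(1,2)] W.scale_right_distrib mult.commute)
qed

lemma bilinear_into_flip:
  "bilinear_into sV sW W f \<Longrightarrow> bilinear_into sV sW W (\<lambda>u v. f v u)"
  unfolding bilinear_into_def by blast

text \<open>Expand the value at \<open>(u + v, u + v)\<close>, which is zero; the two diagonal terms
  vanish as well, so the mixed terms cancel.\<close>

lemma alternating_into_antisym:
  assumes "vector_space sV" and "vector_space sW" and "alternating_into sV sW W \<beta>"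
  shows "\<beta> v u = - \<beta> u v"
proof -
  have "\<beta> (u + v) (u + v) = \<beta> (u + v) u + \<beta> (u + v) v"
    using assms(3) unfolding alternating_into_def bilinear_into_iff[OF assms(1,2)] by blast
  also have "\<dots> = (\<beta> u u + \<beta> v u) + (\<beta> u v + \<beta> v v)"
    using assms(3) unfolding alternating_into_def bilinear_into_iff[OF assms(1,2)] by metis
  finally have "\<beta> (u + v) (u + v) = (\<beta> u u + \<beta> v u) + (\<beta> u v + \<beta> v v)" .
  then have "\<beta> v u + \<beta> u v = 0"
    using assms(3) by (simp add: alternating_into_def)
  then show ?thesis by (simp add: eq_neg_iff_add_eq_0)
qed

lemma alternating_into_alt_part:
  assumes "vector_space sV" and "vector_space sW" and "module.subspace sW W"
    and "bilinear_into sV sW W m"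
  shows "alternating_into sV sW W (alt_part sW m)"
proof -
  interpret W: vector_space sW by fact
  have "bilinear_into sV sW W (\<lambda>u v. sW (1 / 2) (m u v - m v u))"
    by (intro bilinear_into_scale bilinear_into_diff assms bilinear_into_flip[OF assms(4)])
  then show ?thesis
    by (simp add: alternating_into_def alt_part_def[abs_def])
qed

text \<open>Cancels the factor \<open>1 / 2\<close> of \<open>sym_part\<close> and
  \<open>alt_part\<close>; invertibility of 2 enters here.\<close>

lemma (in vector_space) scale_half_double:
  "(2::'a) \<noteq> 0 \<Longrightarrow> scale (1 / 2) (x + x) = x"
  using scale_left_distrib[of 1 1 x] by (metis scale_scale scale_one one_add_one nonzero_divide_eq_eq)

lemma (in vector_space) sym_part_add_alt_part:
  "(2::'a) \<noteq> 0 \<Longrightarrow> sym_part scale m u v + alt_part scale m u v = m u v"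
  unfolding sym_part_def alt_part_def scale_right_distrib[symmetric]
  using scale_half_double[of "m u v"] by (simp add: algebra_simps)

section \<open>Leibniz algebras with an injective linear map into them\<close>

text \<open>The data of an enhanced Leibniz algebra without the product, so that all products on the
  same \<open>t\<close> can be compared. Taking \<open>t = id\<close> on an ideal gives the setting
  of a couple.\<close>

locale leibniz_algebra_embedding =
  V: leibniz_algebra sV br + W: vector_space sW
  for sV :: "'k::field \<Rightarrow> 'v::ab_group_add \<Rightarrow> 'v" and br
    and sW :: "'k \<Rightarrow> 'w::ab_group_add \<Rightarrow> 'w" +
  fixes W :: "'w set" and t :: "'w \<Rightarrow> 'v"
  assumes two_neq_zero: "(2::'k) \<noteq> 0"
    and subspace_W: "W.subspace W"
    and linear_t: "linear_on sW sV W t"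
    and inj_t: "inj_on t W"
begin

lemma t_add: "x \<in> W \<Longrightarrow> y \<in> W \<Longrightarrow> t (x + y) = t x + t y"
  and t_scale: "x \<in> W \<Longrightarrow> t (sW c x) = sV c (t x)"
  using linear_t by (auto simp: linear_on_def)

lemma t_0: "t 0 = 0"
  using t_scale[of 0 0] W.subspace_0[OF subspace_W] by simp

lemma subspace_image: "V.subspace (t ` W)"
  unfolding V.subspace_def
proof (intro conjI ballI allI)
  show "0 \<in> t ` W"
    using t_0 W.subspace_0[OF subspace_W] by (metis image_eqI)
next
  fix x y assume "x \<in> t ` W" "y \<in> t ` W"
  then show "x + y \<in> t ` W"
    using W.subspace_add[OF subspace_W] t_add by (auto simp flip: t_add)
next
  fix c x assume "x \<in> t ` W"
  then show "sV c x \<in> t ` W"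
    using W.subspace_scale[OF subspace_W] by (auto simp flip: t_scale)
qed

lemmas br_bilinear =
  V.bilinear_br[unfolded bilinear_into_iff[OF V.vector_space_axioms V.vector_space_axioms]]
lemmas bilinear_iff = bilinear_into_iff[OF V.vector_space_axioms W.vector_space_axioms]

lemma br_add_left: "br (u + u') v = br u v + br u' v"
  and br_add_right: "br u (v + v') = br u v + br u v'"
  and br_scale_left: "br (sV c u) v = sV c (br u v)"
  and br_scale_right: "br u (sV c v) = sV c (br u v)"
  using br_bilinear by auto

text \<open>Writes the symmetrised bracket through squares, so it lies in every subspace that
  contains all squares.\<close>

lemma br_polarise: "br u v + br v u = br (u + v) (u + v) - br u u - br v v"
  by (simp add: br_add_left br_add_right)

text \<open>Apply \<open>t\<close> to the expansion of \<open>m (u + v) (u + v)\<close> and compare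
  with the polarised bracket.\<close>

lemma t_sym_part:
  assumes "bilinear_into sV sW W m" and "\<And>v. t (m v v) = br v v"
  shows "t (sym_part sW m u v) = sV (1 / 2) (br u v + br v u)"
proof -
  have in_W: "m x y \<in> W" for x y using assms(1) bilinear_iff by blast
  have sum: "m u v + m v u \<in> W" using in_W W.subspace_add[OF subspace_W] by blast
  \<comment> \<open>The mixed terms are grouped because \<open>t\<close> is additive only on
    \<open>W\<close>, and each group lies in \<open>W\<close>.\<close>
  have "m (u + v) (u + v) = (m u v + m v u) + (m u u + m v v)"
    using assms(1) by (simp add: bilinear_iff algebra_simps)
  then have "br (u + v) (u + v) = t (m u v + m v u) + (br u u + br v v)"
    using in_W sum W.subspace_add[OF subspace_W] by (metis assms(2) t_add)
  then show ?thesis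
    unfolding sym_part_def t_scale[OF sum] by (simp add: br_polarise)
qed

text \<open>Squares lie in the image by \<open>br_self\<close>, and the image is left central by
  \<open>br_t\<close>. For \<open>x\<close> in the image \<open>br x v\<close> vanishes, so
  \<open>br v x\<close> is already the symmetrised bracket, a combination of squares.\<close>

lemma leibniz_couple_if_enhanced:
  assumes "enhanced_leibniz_algebra sV br sW W t m"
  shows "leibniz_couple sV br (t ` W)"
proof -
  interpret E: enhanced_leibniz_algebra sV br sW W t m by fact
  have sq: "br v v \<in> t ` W" for v
    using E.bilinear_m E.br_self[of v] bilinear_iff by auto
  have ideal: "br v x \<in> t ` W" if "x \<in> t ` W" for v x
  proof -
    have "br x v = 0" using that E.br_t by auto
    then have "br v x = br (v + x) (v + x) - br v v - br x x"
      using br_polarise[of v x] by simp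
    then show ?thesis using sq V.subspace_diff[OF subspace_image] by metis
  qed
  show ?thesis
  proof
    show "V.left_ideal (t ` W)"
      using subspace_image ideal by (simp add: V.left_ideal_def)
    show "V.Sq \<subseteq> t ` W"
      unfolding V.Sq_def using sq subspace_image by (intro V.span_minimal) auto
    show "t ` W \<subseteq> V.left_center"
      using E.br_t by (auto simp: V.left_center_def)
  qed
qed

text \<open>The workhorse of the development: over a Leibniz couple, an enhanced structure is a
  bilinear product with prescribed diagonal. Injectivity of \<open>t\<close> lets the other axioms
  on \<open>m\<close> be checked in the Leibniz algebra.\<close>

lemma enhanced_iff:
  "enhanced_leibniz_algebra sV br sW W t m \<longleftrightarrow>
    leibniz_couple sV br (t ` W) \<and> bilinear_into sV sW W m \<and> (\<forall>v. t (m v v) = br v v)"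
proof (intro iffI conjI allI)
  assume E: "enhanced_leibniz_algebra sV br sW W t m"
  then show "leibniz_couple sV br (t ` W)" by (rule leibniz_couple_if_enhanced)
  show "bilinear_into sV sW W m" "t (m v v) = br v v" for v
    using enhanced_leibniz_algebra.bilinear_m[OF E] enhanced_leibniz_algebra.br_self[OF E] by simp_all
next
  assume asm: "leibniz_couple sV br (t ` W) \<and> bilinear_into sV sW W m \<and> (\<forall>v. t (m v v) = br v v)"
  then interpret C: leibniz_couple sV br "t ` W" by blast
  have bil: "bilinear_into sV sW W m" and sq: "\<And>v. t (m v v) = br v v" using asm by auto
  have in_W: "m x y \<in> W" for x y using bil bilinear_iff by blast
  have sym_in_W: "sym_part sW m x y \<in> W" for x y
    unfolding sym_part_def
    by (intro W.subspace_scale[OF subspace_W] W.subspace_add[OF subspace_W] in_W)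
  have center: "br (t w) v = 0" if "w \<in> W" for w v
    using that C.subset_left_center by (auto simp: V.left_center_def)
  have eqI: "x = y" if "t x = t y" "x \<in> W" "y \<in> W" for x y
    using that inj_t by (auto dest: inj_onD)
  show "enhanced_leibniz_algebra sV br sW W t m"
  proof
    show "W.subspace W" "linear_on sW sV W t" "bilinear_into sV sW W m"
      by (fact subspace_W linear_t bil)+
  next
    fix w v assume "w \<in> W"
    then show "br (t w) v = 0" by (rule center)
  next
    fix w assume "w \<in> W"
    then have "t (m (t w) (t w)) = t 0" by (simp add: sq center t_0)
    then show "m (t w) (t w) = 0" using in_W W.subspace_0[OF subspace_W] eqI by blast
  next
    fix u v
    \<comment> \<open>Squares are left central, so this term can be added to complete
      \<open>br u (br v v)\<close> to a symmetrised bracket. The Leibniz identity for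
      \<open>u, v, v\<close> already gives the other one.\<close>
    have "br (br v v) u = 0" using center[OF in_W[of v v]] by (simp add: sq)
    then have "br u (br v v) + br (br v v) u = br v (br u v) + br (br u v) v"
      using V.left_leibniz[of u v v] by simp
    then have "t (sym_part sW m u (br v v)) = t (sym_part sW m v (br u v))"
      by (simp add: t_sym_part[OF bil sq])
    then show "sym_part sW m u (br v v) = sym_part sW m v (br u v)"
      using sym_in_W eqI by blast
  next
    show "br v v = t (m v v)" for v by (simp add: sq)
  qed
qed

section \<open>The canonical symmetric product\<close>

text \<open>The preimage under \<open>t\<close> of half the symmetrised bracket.
  \<open>inv_into\<close> makes it a total function; it is a true preimage once the image of
  \<open>t\<close> forms a Leibniz couple.\<close>

definition sym_product :: "'v \<Rightarrow> 'v \<Rightarrow> 'w"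
  where "sym_product u v = inv_into W t (sV (1 / 2) (br u v + br v u))"

lemma sym_product_commute: "sym_product u v = sym_product v u"
  by (simp add: sym_product_def add.commute)

text \<open>The uniqueness half: \<open>t\<close> sends both sides to the same vector, and it is
  injective on \<open>W\<close>.\<close>

lemma sym_part_eq_sym_product:
  assumes "enhanced_leibniz_algebra sV br sW W t m"
  shows "sym_part sW m = sym_product"
proof (intro ext)
  fix u v
  have bil: "bilinear_into sV sW W m" and sq: "\<And>v. t (m v v) = br v v"
    using assms enhanced_iff by auto
  have "sym_part sW m u v \<in> W"
    unfolding sym_part_def using bil bilinear_iff
    by (intro W.subspace_scale[OF subspace_W] W.subspace_add[OF subspace_W]) auto
  then show "sym_part sW m u v = sym_product u v"
    unfolding sym_product_def t_sym_part[OF bil sq, symmetric] using inj_t by simp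
qed

context
  assumes couple: "leibniz_couple sV br (t ` W)"
begin

text \<open>By polarisation the symmetrised bracket is a combination of squares, which a couple
  places in the image of \<open>t\<close>.\<close>

lemma sym_product_in: "sym_product u v \<in> W"
  and t_sym_product: "t (sym_product u v) = sV (1 / 2) (br u v + br v u)"
proof -
  interpret C: leibniz_couple sV br "t ` W" by (fact couple)
  have "br x x \<in> t ` W" for x
    by (rule subsetD[OF C.Sq_subset]) (auto simp: V.Sq_def intro: V.span_base)
  then have "br u v + br v u \<in> t ` W"
    unfolding br_polarise by (intro V.subspace_diff[OF subspace_image])
  then have "sV (1 / 2) (br u v + br v u) \<in> t ` W"
    by (rule V.subspace_scale[OF subspace_image])
  then show "sym_product u v \<in> W" "t (sym_product u v) = sV (1 / 2) (br u v + br v u)"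
    unfolding sym_product_def by (simp_all add: inv_into_into f_inv_into_f)
qed

lemma bilinear_sym_product: "bilinear_into sV sW W sym_product"
proof -
  have eqI: "x = y" if "t x = t y" "x \<in> W" "y \<in> W" for x y
    using that inj_t by (auto dest: inj_onD)
  have add: "sym_product u (v + v') = sym_product u v + sym_product u v'" for u v v'
    by (rule eqI)
      (simp_all add: t_add sym_product_in W.subspace_add[OF subspace_W] t_sym_product
        br_add_left br_add_right algebra_simps)
  have scale: "sym_product u (sV c v) = sW c (sym_product u v)" for c u v
    by (rule eqI)
      (simp_all add: t_scale sym_product_in W.subspace_scale[OF subspace_W] t_sym_product
        br_scale_left br_scale_right V.scale_right_distrib mult.commute)
  show ?thesis
    unfolding bilinear_iff
    \<comment> \<open>Linearity in the first argument follows from that in the second by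
      commutativity.\<close>
    using add scale sym_product_in by (metis sym_product_commute)
qed

lemma enhanced_sym_product: "enhanced_leibniz_algebra sV br sW W t sym_product"
  using couple bilinear_sym_product
  by (simp add: enhanced_iff t_sym_product V.scale_half_double[OF two_neq_zero])

text \<open>A symmetric product equals its own symmetric part, which is forced to be
  \<open>sym_product\<close>.\<close>

lemma symmetric_enhanced_iff:
  "symmetric_enhanced_leibniz_algebra sV br sW W t m \<longleftrightarrow> m = sym_product"
proof
  assume S: "symmetric_enhanced_leibniz_algebra sV br sW W t m"
  then interpret S: symmetric_enhanced_leibniz_algebra sV br sW W t m .
  have "m u v = sym_part sW m u v" for u v
    unfolding sym_part_def S.symmetric_m[of v u]
    by (simp add: W.scale_half_double[OF two_neq_zero])
  then show "m = sym_product"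
    using sym_part_eq_sym_product[OF S.enhanced_leibniz_algebra_axioms] by (simp add: fun_eq_iff)
next
  assume "m = sym_product"
  then show "symmetric_enhanced_leibniz_algebra sV br sW W t m"
    using enhanced_sym_product sym_product_commute
    by (simp add: symmetric_enhanced_leibniz_algebra_def
        symmetric_enhanced_leibniz_algebra_axioms_def)
qed

text \<open>By \<open>enhanced_iff\<close> only bilinearity and the diagonal matter, and an
  alternating map leaves the diagonal unchanged.\<close>

lemma enhanced_add_alternating:
  assumes "alternating_into sV sW W \<beta>"
  shows "enhanced_leibniz_algebra sV br sW W t (\<lambda>u v. sym_product u v + \<beta> u v)"
  using assms couple bilinear_sym_product subspace_W
  by (auto simp: enhanced_iff alternating_into_def t_sym_product
      V.scale_half_double[OF two_neq_zero]
      intro: bilinear_into_add[OF V.vector_space_axioms W.vector_space_axioms])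

end

section \<open>Symmetric and alternating parts of a general product\<close>

lemma enhanced_eq_sym_product_add_alt_part:
  assumes "enhanced_leibniz_algebra sV br sW W t m"
  shows "m u v = sym_product u v + alt_part sW m u v"
  using sym_part_eq_sym_product[OF assms] W.sym_part_add_alt_part[OF two_neq_zero, of m u v]
  by simp

lemma alternating_alt_part:
  assumes "enhanced_leibniz_algebra sV br sW W t m"
  shows "alternating_into sV sW W (alt_part sW m)"
  using assms subspace_W enhanced_iff V.vector_space_axioms W.vector_space_axioms
  by (intro alternating_into_alt_part) auto

text \<open>The symmetric summand cancels in the difference, and antisymmetry doubles
  \<beta>.\<close>

lemma alt_part_sym_product_add:
  assumes "alternating_into sV sW W \<beta>"
  shows "alt_part sW (\<lambda>u v. sym_product u v + \<beta> u v) = \<beta>"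
proof (intro ext)
  fix u v
  have "\<beta> v u = - \<beta> u v"
    by (rule alternating_into_antisym[OF V.vector_space_axioms W.vector_space_axioms assms])
  then show "alt_part sW (\<lambda>u v. sym_product u v + \<beta> u v) u v = \<beta> u v"
    by (simp add: alt_part_def sym_product_commute[of v u] W.scale_half_double[OF two_neq_zero])
qed

lemma bij_betw_alternating_enhanced:
  assumes "leibniz_couple sV br (t ` W)"
  shows "bij_betw (\<lambda>\<beta> u v. sym_product u v + \<beta> u v)
    {\<beta>. alternating_into sV sW W \<beta>} {m. enhanced_leibniz_algebra sV br sW W t m}"
proof (rule bij_betw_byWitness[where f' = "alt_part sW"])
  show "\<forall>m\<in>{m. enhanced_leibniz_algebra sV br sW W t m}.
      (\<lambda>u v. sym_product u v + alt_part sW m u v) = m"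
    using enhanced_eq_sym_product_add_alt_part by (auto simp: fun_eq_iff)
qed (use alt_part_sym_product_add alternating_alt_part enhanced_add_alternating[OF assms] in auto)

text \<open>Identifies \<open>W\<close> with its image: the couple is the same on both sides, and
  bilinearity and the diagonal condition are carried over by linearity of \<open>t\<close>.\<close>

lemma enhanced_image:
  assumes "enhanced_leibniz_algebra sV br sW W t m"
  shows "enhanced_leibniz_algebra sV br sV (t ` W) id (\<lambda>u v. t (m u v))"
proof -
  interpret I: leibniz_algebra_embedding sV br sV "t ` W" id
    by unfold_locales (auto simp: linear_on_def two_neq_zero subspace_image)
  show ?thesis
    using assms unfolding enhanced_iff I.enhanced_iff bilinear_iff I.bilinear_iff
    by (simp add: t_add t_scale)
qed

end

section \<open>Global correspondences with Leibniz couples\<close>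

lemma leibniz_algebra_embedding_if_couple:
  assumes "(2::'k::field) \<noteq> 0" and "leibniz_couple sV br I"
  shows "leibniz_algebra_embedding (sV :: 'k \<Rightarrow> 'v::ab_group_add \<Rightarrow> 'v) br sV I id"
proof -
  interpret leibniz_couple sV br I by fact
  show ?thesis
    by unfold_locales (use assms left_ideal_I in \<open>auto simp: left_ideal_def linear_on_def\<close>)
qed

lemma enhanced_leibniz_algebra_embedding:
  assumes "(2::'k::field) \<noteq> 0" and "enhanced_leibniz_algebra sV br sW W t m" and "inj_on t W"
  shows "leibniz_algebra_embedding (sV :: 'k \<Rightarrow> 'v::ab_group_add \<Rightarrow> 'v) br sW W t"
proof -
  interpret enhanced_leibniz_algebra sV br sW W t m by fact
  show ?thesis
    by unfold_locales (use assms subspace_W linear_t in auto)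
qed

lemma leibniz_couple_if_enhanced_id:
  assumes "(2::'k::field) \<noteq> 0"
    and "enhanced_leibniz_algebra (sV :: 'k \<Rightarrow> 'v::ab_group_add \<Rightarrow> 'v) br sV I id m"
  shows "leibniz_couple sV br I"
  using leibniz_algebra_embedding.leibniz_couple_if_enhanced[OF
      enhanced_leibniz_algebra_embedding[OF assms] assms(2)]
  by simp

text \<open>Here bracket and ideal vary over a fixed vector space, and the inclusion of the ideal
  serves as \<open>t\<close>. The inverse equips a couple with its canonical product.\<close>

lemma bij_betw_symmetric_enhanced_couple:
  assumes two: "(2::'k::field) \<noteq> 0"
  shows "bij_betw (\<lambda>(br, I, m). (br, I))
    {(br, I, m). symmetric_enhanced_leibniz_algebra (sV :: 'k \<Rightarrow> 'v::ab_group_add \<Rightarrow> 'v) br sV I id m}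
    {(br, I). leibniz_couple sV br I}"
proof -
  have couple: "leibniz_couple sV br I"
    if "symmetric_enhanced_leibniz_algebra sV br sV I id m" for br I m
    using leibniz_couple_if_enhanced_id[OF two]
      symmetric_enhanced_leibniz_algebra.axioms(1)[OF that] by blast
  have sym_iff: "symmetric_enhanced_leibniz_algebra sV br sV I id m \<longleftrightarrow>
      m = leibniz_algebra_embedding.sym_product sV br I id"
    if "leibniz_couple sV br I" for br I m
    using leibniz_algebra_embedding.symmetric_enhanced_iff[OF
        leibniz_algebra_embedding_if_couple[OF two that]] that by simp
  show ?thesis
    by (rule bij_betw_byWitness[where
          f' = "\<lambda>(br, I). (br, I, leibniz_algebra_embedding.sym_product sV br I id)"])
      (use couple sym_iff couple[THEN sym_iff, THEN iffD1, symmetric] in auto)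
qed

text \<open>The inverse adds \<beta> to the canonical product of the couple. Products take values in
  the ideal, so \<open>alt_part\<close> is formed with the scaling \<open>sV\<close>.\<close>

lemma bij_betw_enhanced_couple_alternating:
  assumes two: "(2::'k::field) \<noteq> 0"
  shows "bij_betw (\<lambda>(br, I, m). (br, I, alt_part sV m))
    {(br, I, m). enhanced_leibniz_algebra (sV :: 'k \<Rightarrow> 'v::ab_group_add \<Rightarrow> 'v) br sV I id m}
    {(br, I, \<beta>). leibniz_couple sV br I \<and> alternating_into sV sV I \<beta>}"
proof -
  let ?s = "\<lambda>br I. leibniz_algebra_embedding.sym_product sV br I id"
  note couple = leibniz_couple_if_enhanced_id[OF two]
  note emb = leibniz_algebra_embedding_if_couple[OF two]
  have decomp: "(\<lambda>u v. ?s br I u v + alt_part sV m u v) = m"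
    if "enhanced_leibniz_algebra sV br sV I id m" for br I m
    using leibniz_algebra_embedding.enhanced_eq_sym_product_add_alt_part[OF
        emb[OF couple[OF that]] that] by (simp add: fun_eq_iff)
  have alt: "alternating_into sV sV I (alt_part sV m)"
    if "enhanced_leibniz_algebra sV br sV I id m" for br I m
    using leibniz_algebra_embedding.alternating_alt_part[OF emb[OF couple[OF that]] that] .
  have alt_add: "alt_part sV (\<lambda>u v. ?s br I u v + \<beta> u v) = \<beta>"
    if "leibniz_couple sV br I" "alternating_into sV sV I \<beta>" for br I \<beta>
    using leibniz_algebra_embedding.alt_part_sym_product_add[OF emb[OF that(1)] that(2)] .
  have enh: "enhanced_leibniz_algebra sV br sV I id (\<lambda>u v. ?s br I u v + \<beta> u v)"
    if "leibniz_couple sV br I" "alternating_into sV sV I \<beta>" for br I \<beta>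
    using leibniz_algebra_embedding.enhanced_add_alternating[OF emb[OF that(1)] _ that(2)] that(1)
    by simp
  show ?thesis
    by (rule bij_betw_byWitness[where
          f' = "\<lambda>(br, I, \<beta>). (br, I, \<lambda>u v. ?s br I u v + \<beta> u v)"])
      (use couple decomp alt alt_add enh in auto)
qed

theorem proposition2p3:
  fixes sV :: "'k::field \<Rightarrow> 'v::ab_group_add \<Rightarrow> 'v"
    and sW :: "'k \<Rightarrow> 'w::ab_group_add \<Rightarrow> 'w"
  assumes "CHAR('k) \<noteq> 2" and "vector_space sV" and "vector_space sW"
  shows
    \<comment> \<open>the correspondences, with \<open>W\<close> identified with its image \<open>I\<close>\<close>
    "bij_betw (\<lambda>(br, I, m). (br, I))
       {(br, I, m). symmetric_enhanced_leibniz_algebra sV br sV I id m}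
       {(br, I). leibniz_couple sV br I}
     \<and> bij_betw (\<lambda>(br, I, m). (br, I, alt_part sV m))
       {(br, I, m). enhanced_leibniz_algebra sV br sV I id m}
       {(br, I, \<beta>). leibniz_couple sV br I \<and> alternating_into sV sV I \<beta>}
     \<and>
     \<comment> \<open>the identification, for an arbitrary injective \<open>t\<close>\<close>
     (\<forall>br W t m. enhanced_leibniz_algebra sV br sW W t m \<and> inj_on t W \<longrightarrow>
        leibniz_couple sV br (t ` W) \<and>
        enhanced_leibniz_algebra sV br sV (t ` W) id (\<lambda>u v. t (m u v)))
     \<and>
     \<comment> \<open>the correspondences for an arbitrary injective \<open>t\<close>\<close>
     (\<forall>br W t. leibniz_algebra sV br \<and> module.subspace sW W \<and> linear_on sW sV W t \<and>
        inj_on t W \<and> leibniz_couple sV br (t ` W) \<longrightarrow>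
        (\<exists>!m. symmetric_enhanced_leibniz_algebra sV br sW W t m) \<and>
        (\<forall>m. symmetric_enhanced_leibniz_algebra sV br sW W t m \<longrightarrow>
           bij_betw (\<lambda>\<beta> u v. m u v + \<beta> u v)
             {\<beta>. alternating_into sV sW W \<beta>}
             {m'. enhanced_leibniz_algebra sV br sW W t m'}))"
proof (intro conjI allI impI)
  have two: "(2::'k) \<noteq> 0" using assms(1) by (rule two_neq_zero_if_CHAR_neq_2)
  show "bij_betw (\<lambda>(br, I, m). (br, I))
      {(br, I, m). symmetric_enhanced_leibniz_algebra sV br sV I id m}
      {(br, I). leibniz_couple sV br I}"
    by (rule bij_betw_symmetric_enhanced_couple[OF two])
  show "bij_betw (\<lambda>(br, I, m). (br, I, alt_part sV m))
      {(br, I, m). enhanced_leibniz_algebra sV br sV I id m}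
      {(br, I, \<beta>). leibniz_couple sV br I \<and> alternating_into sV sV I \<beta>}"
    by (rule bij_betw_enhanced_couple_alternating[OF two])
  show "leibniz_couple sV br (t ` W)"
    and "enhanced_leibniz_algebra sV br sV (t ` W) id (\<lambda>u v. t (m u v))"
    if "enhanced_leibniz_algebra sV br sW W t m \<and> inj_on t W" for br W t m
  proof -
    interpret leibniz_algebra_embedding sV br sW W t
      using that by (blast intro: enhanced_leibniz_algebra_embedding[OF two])
    show "leibniz_couple sV br (t ` W)"
      and "enhanced_leibniz_algebra sV br sV (t ` W) id (\<lambda>u v. t (m u v))"
      using that leibniz_couple_if_enhanced enhanced_image by blast+
  qed
  fix br W t
  assume asm: "leibniz_algebra sV br \<and> module.subspace sW W \<and> linear_on sW sV W t \<and>
    inj_on t W \<and> leibniz_couple sV br (t ` W)"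
  interpret leibniz_algebra_embedding sV br sW W t
    using asm assms(3) two
    by (simp add: leibniz_algebra_embedding_def leibniz_algebra_embedding_axioms_def)
  have couple: "leibniz_couple sV br (t ` W)" using asm by blast
  show "\<exists>!m. symmetric_enhanced_leibniz_algebra sV br sW W t m"
    by (simp add: symmetric_enhanced_iff[OF couple])
  show "bij_betw (\<lambda>\<beta> u v. m u v + \<beta> u v)
      {\<beta>. alternating_into sV sW W \<beta>} {m'. enhanced_leibniz_algebra sV br sW W t m'}"
    if "symmetric_enhanced_leibniz_algebra sV br sW W t m" for m
    \<comment> \<open>The given symmetric \<open>m\<close> must be \<open>sym_product\<close>, for
      which the bijection is known.\<close>
    using that bij_betw_alternating_enhanced[OF couple]
    by (simp add: symmetric_enhanced_iff[OF couple])
qed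

end
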